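(* Let $K$ be a compact Hausdorff space and let $X$ be any Banach space. Then $f \in C(K,X)$ is a very smooth point of $C(K,X)$ if and only if there exists a unique point $k \in K$ which is an isolated point such that $f(k)$ is a very smooth point of $X$.
   Context: $C(K,X)$ is the Banach space of $X$-valued continuous functions on $K$, equipped with the supremum norm. A unit vector $x$ of a Banach space $Z$ is a smooth point of $Z$ if it has a unique norming functional in the dual, i.e. there is exactly one $z^* \in Z^*$ with $\|z^*\| = 1 = z^*(x)$. A unit vector $x$ of a Banach space $Z$ is a very smooth point of $Z$ if, regarded as an element of $Z^{**}$ under the canonical embedding $Z \subset Z^{**}$, it is a smooth point of $Z^{**}$.
   Formalization: The unique point k is taken to be the only point where f attains its norm; without this the converse fails (K two points, X two-dimensional l^1, f(1) smooth and f(2) a non-smooth unit vector). Banach spaces are real. *)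

theory Defs
  imports "HOL-Analysis.Analysis"
begin

definition smooth_point :: "'a::real_normed_vector \<Rightarrow> bool"
  where "smooth_point z \<longleftrightarrow>
    norm z = 1 \<and> (\<exists>!\<phi> :: 'a \<Rightarrow>\<^sub>L real. norm \<phi> = 1 \<and> blinfun_apply \<phi> z = 1)"

definition bidual_embed :: "'a::real_normed_vector \<Rightarrow> (('a \<Rightarrow>\<^sub>L real) \<Rightarrow>\<^sub>L real)"
  where "bidual_embed z = Blinfun (\<lambda>\<phi>. blinfun_apply \<phi> z)"

(* Blinfun is only meaningful on bounded linear maps; this confirms that it is applied to one. *)
lemma bidual_embed_apply [simp]: "blinfun_apply (bidual_embed z) \<phi> = blinfun_apply \<phi> z"
  unfolding bidual_embed_def
  by (simp add: bounded_linear_Blinfun_apply blinfun.bounded_linear_left)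

definition very_smooth_point :: "'a::real_normed_vector \<Rightarrow> bool"
  where "very_smooth_point z \<longleftrightarrow> norm z = 1 \<and> smooth_point (bidual_embed z)"

end

theory Submission
  imports Defs
begin

text \<open>
  Very smoothness of \<open>z\<close> says that on the bidual there is only one functional \<open>\<Phi>\<close> of norm at most 1
  with \<open>\<Phi> z = 1\<close>; such a functional is said to be norming at \<open>z\<close>. Existence is automatic, because a
  norming functional \<open>\<phi>\<close> of \<open>z\<close> in the dual acts on the bidual as evaluation at \<open>\<phi>\<close>. Both directions
  thus concern uniqueness only.

  Necessity. A norming functional \<open>\<phi>\<close> of \<open>f k\<close>, where \<open>f\<close> attains its norm at \<open>k\<close>, gives the
  norming functional \<open>\<phi> \<circ> \<delta>\<^sub>k\<close> of \<open>f\<close>, where \<open>\<delta>\<^sub>k\<close> is evaluation at \<open>k\<close>. Two such points give two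
  different functionals by Urysohn's lemma. If \<open>k\<close> were not isolated, there would be two norming
  functionals on the bidual: evaluation at \<open>\<phi> \<circ> \<delta>\<^sub>k\<close>, and a generalised limit of the evaluations at
  \<open>\<phi> \<circ> \<delta>\<^sub>l\<close> for \<open>l \<rightarrow> k\<close>, \<open>l \<noteq> k\<close>. Continuity of \<open>f\<close> makes the second one norming. The two differ
  at the element of the bidual that measures the mass which a functional has at \<open>k\<close>
  (\<open>ex_point_mass_functional\<close>): it is 1 at \<open>\<phi> \<circ> \<delta>\<^sub>k\<close> and 0 at every \<open>\<phi> \<circ> \<delta>\<^sub>l\<close> with \<open>l \<noteq> k\<close>.
  Finally, constant functions make \<open>\<delta>\<^sub>k\<close> a norm-one retraction onto \<open>X\<close>, and norming functionals
  at \<open>f k\<close> pull back along its second adjoint to norming functionals at \<open>f\<close>, injectively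
  (\<open>very_smooth_point_retract\<close>).

  Sufficiency. If \<open>k\<close> is isolated, then by compactness \<open>f\<close> stays below \<open>1 - s\<close> in norm off \<open>k\<close>, for
  some \<open>s > 0\<close>. Hence \<open>f\<close> can be perturbed by \<open>s\<close> times anything in the unit ball that vanishes at
  \<open>k\<close> without leaving the unit ball, and the same holds in the bidual. A norming functional kills
  all such perturbations, so it depends only on the part at \<open>k\<close>, that is, it factors through
  \<open>X\<^sup>*\<^sup>*\<close>, where it is unique (\<open>very_smooth_point_lift\<close>).

  All functionals are produced by one form of the Hahn-Banach theorem (\<open>Hahn_Banach_cone\<close>), in which
  the prescribed lower bounds on the functional form a convex cone.
\<close>

section \<open>Hahn-Banach for cones of lower bounds\<close>

definition sublinear :: "('a::real_vector \<Rightarrow> real) \<Rightarrow> bool"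
  where "sublinear q \<longleftrightarrow>
    (\<forall>x y. q (x + y) \<le> q x + q y) \<and> (\<forall>t\<ge>0. \<forall>x. q (t *\<^sub>R x) = t * q x)"

lemma sublinearI:
  assumes "\<And>x y. q (x + y) \<le> q x + q y" and "q 0 = 0"
    and "\<And>t x. t > 0 \<Longrightarrow> q (t *\<^sub>R x) \<le> t * q x"
  shows "sublinear q"
  unfolding sublinear_def
proof (intro conjI allI impI)
  fix t :: real and x assume "0 \<le> t"
  show "q (t *\<^sub>R x) = t * q x"
  proof (cases "t = 0")
    case False
    then have t: "t > 0" using \<open>0 \<le> t\<close> by simp
    have "q (inverse t *\<^sub>R t *\<^sub>R x) \<le> inverse t * q (t *\<^sub>R x)"
      using t by (intro assms(3)) simp
    then have "t * q x \<le> q (t *\<^sub>R x)"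
      using t by (simp add: field_simps)
    then show ?thesis using assms(3)[OF t, of x] by simp
  qed (simp add: assms(2))
qed (rule assms(1))

lemma sublinear_add: "sublinear q \<Longrightarrow> q (x + y) \<le> q x + q y"
  and sublinear_scaleR: "sublinear q \<Longrightarrow> t \<ge> 0 \<Longrightarrow> q (t *\<^sub>R x) = t * q x"
  by (simp_all add: sublinear_def)

lemma sublinear_zero: "sublinear q \<Longrightarrow> q 0 = 0"
  using sublinear_scaleR[of q 0 0] by simp

lemma sublinear_minus: "sublinear q \<Longrightarrow> - q (- x) \<le> q x"
  using sublinear_add[of q x "- x"] by (simp add: sublinear_zero)

lemma sublinear_norm: "sublinear (norm :: 'a::real_normed_vector \<Rightarrow> real)"
  by (simp add: sublinear_def norm_triangle_ineq)

text \<open>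
  For \<open>c \<le> q x\<close> on the convex cone \<open>G\<close>, this is the largest sublinear functional \<open>p \<le> q\<close> with
  \<open>p (- x) \<le> - c\<close> on \<open>G\<close>; a linear functional below it therefore satisfies \<open>c \<le> g x\<close> on \<open>G\<close>.
\<close>

definition lower_by :: "('a::real_vector \<times> real) set \<Rightarrow> ('a \<Rightarrow> real) \<Rightarrow> 'a \<Rightarrow> real"
  where "lower_by G q y = (INF (x, c)\<in>G. q (y + x) - c)"

context
  fixes q :: "'a::real_vector \<Rightarrow> real" and G
  assumes q: "sublinear q" and G: "convex_cone G"
    and le: "\<And>x c. (x, c) \<in> G \<Longrightarrow> c \<le> q x"
begin

lemma lower_by_upper: "(x, c) \<in> G \<Longrightarrow> lower_by G q y \<le> q (y + x) - c"
proof -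
  have "bdd_below ((\<lambda>(x, c). q (y + x) - c) ` G)"
  proof (rule bdd_belowI2[where m = "- q (- y)"], clarify)
    fix x c assume "(x, c) \<in> G"
    then show "- q (- y) \<le> q (y + x) - c"
      using le[of x c] sublinear_add[OF q, of "- y" "y + x"] by simp
  qed
  then show "lower_by G q y \<le> q (y + x) - c" if "(x, c) \<in> G"
    unfolding lower_by_def using cINF_lower[OF _ that] by fastforce
qed

lemma lower_by_greatest:
  "(\<And>x c. (x, c) \<in> G \<Longrightarrow> m \<le> q (y + x) - c) \<Longrightarrow> m \<le> lower_by G q y"
  unfolding lower_by_def using convex_cone_nonempty[OF G] by (intro cINF_greatest) auto

lemma lower_by_le: "lower_by G q y \<le> q y"
  using lower_by_upper[of 0 0 y] G by (simp add: convex_cone_iff zero_prod_def)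

lemma lower_by_constraint: "(x, c) \<in> G \<Longrightarrow> lower_by G q (- x) \<le> - c"
  using lower_by_upper[of x c "- x"] by (simp add: sublinear_zero[OF q])

lemma sublinear_lower_by: "sublinear (lower_by G q)"
proof (rule sublinearI)
  show "lower_by G q 0 = 0"
  proof (rule antisym)
    show "lower_by G q 0 \<le> 0"
      using lower_by_le[of 0] by (simp add: sublinear_zero[OF q])
    show "0 \<le> lower_by G q 0"
      by (rule lower_by_greatest) (simp add: le)
  qed
next
  fix x y
  have "lower_by G q (x + y) - lower_by G q x \<le> lower_by G q y"
  proof (rule lower_by_greatest)
    fix b d assume b: "(b, d) \<in> G"
    have "lower_by G q (x + y) - (q (y + b) - d) \<le> lower_by G q x"
    proof (rule lower_by_greatest)
      fix a c assume a: "(a, c) \<in> G"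
      have "(a + b, c + d) \<in> G"
        using convex_cone_add[OF G a b] by simp
      then have "lower_by G q (x + y) \<le> q ((x + y) + (a + b)) - (c + d)"
        by (rule lower_by_upper)
      also have "q ((x + y) + (a + b)) \<le> q (x + a) + q (y + b)"
        using sublinear_add[OF q, of "x + a" "y + b"] by (simp add: algebra_simps)
      finally show "lower_by G q (x + y) - (q (y + b) - d) \<le> q (x + a) - c" by simp
    qed
    then show "lower_by G q (x + y) - lower_by G q x \<le> q (y + b) - d" by simp
  qed
  then show "lower_by G q (x + y) \<le> lower_by G q x + lower_by G q y" by simp
next
  fix t :: real and x assume t: "0 < t"
  have "inverse t * lower_by G q (t *\<^sub>R x) \<le> lower_by G q x"
  proof (rule lower_by_greatest)
    fix a c assume "(a, c) \<in> G"
    then have "(t *\<^sub>R a, t * c) \<in> G"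
      using convex_cone_scaleR[OF G, of t "(a, c)"] t by simp
    then have "lower_by G q (t *\<^sub>R x) \<le> q (t *\<^sub>R x + t *\<^sub>R a) - t * c"
      by (rule lower_by_upper)
    also have "q (t *\<^sub>R x + t *\<^sub>R a) = t * q (x + a)"
      using sublinear_scaleR[OF q, of t "x + a"] t by (simp add: scaleR_right_distrib)
    finally show "inverse t * lower_by G q (t *\<^sub>R x) \<le> q (x + a) - c"
      using t by (simp add: field_simps)
  qed
  then show "lower_by G q (t *\<^sub>R x) \<le> t * lower_by G q x"
    using t by (simp add: field_simps)
qed

end

lemma convex_cone_ray: "convex_cone {t *\<^sub>R v | t. 0 \<le> t}"
  unfolding convex_cone_iff
proof (intro conjI ballI allI impI)
  show "0 \<in> {t *\<^sub>R v | t. 0 \<le> t}"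
    by (auto intro: exI[of _ 0])
next
  fix x y assume "x \<in> {t *\<^sub>R v | t. 0 \<le> t}" "y \<in> {t *\<^sub>R v | t. 0 \<le> t}"
  then obtain s t where "x = s *\<^sub>R v" "0 \<le> s" "y = t *\<^sub>R v" "0 \<le> t" by blast
  then have "x + y = (s + t) *\<^sub>R v" "0 \<le> s + t" by (simp_all add: scaleR_add_left)
  then show "x + y \<in> {t *\<^sub>R v | t. 0 \<le> t}" by blast
next
  fix x and c :: real assume "x \<in> {t *\<^sub>R v | t. 0 \<le> t}" "0 \<le> c"
  then obtain t where "x = t *\<^sub>R v" "0 \<le> t" by blast
  then have "c *\<^sub>R x = (c * t) *\<^sub>R v" "0 \<le> c * t" using \<open>0 \<le> c\<close> by simp_all
  then show "c *\<^sub>R x \<in> {t *\<^sub>R v | t. 0 \<le> t}" by blast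
qed

text \<open>
  Lowering \<open>q\<close> along the ray through \<open>(a, q a)\<close> changes nothing by minimality, and this forces
  \<open>q y + q a \<le> q (y + a)\<close>, the converse of subadditivity.
\<close>

lemma linear_if_minimal_sublinear:
  fixes q :: "'a::real_vector \<Rightarrow> real"
  assumes q: "sublinear q"
    and minimal: "\<And>r. sublinear r \<Longrightarrow> r \<le> q \<Longrightarrow> r = q"
  shows "linear q"
proof -
  have add: "q (y + a) = q y + q a" for y a
  proof -
    define G where "G = {t *\<^sub>R (a, q a) | t. 0 \<le> t}"
    have G: "convex_cone G"
      unfolding G_def by (rule convex_cone_ray)
    have le: "c \<le> q x" if "(x, c) \<in> G" for x c
      using that by (auto simp: G_def sublinear_scaleR[OF q])
    have "lower_by G q = q"
      using sublinear_lower_by[OF q G le] lower_by_le[OF q G le]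
      by (intro minimal) (auto simp: le_fun_def)
    moreover have "(a, q a) \<in> G" unfolding G_def by (auto intro!: exI[of _ 1])
    ultimately have "q y \<le> q (y + a) - q a"
      using lower_by_upper[OF q G le, of a "q a" y] by simp
    then show ?thesis using sublinear_add[OF q, of y a] by simp
  qed
  have neg: "q (- x) = - q x" for x
    using add[of x "- x"] by (simp add: sublinear_zero[OF q])
  show ?thesis
  proof (rule linearI)
    show "q (c *\<^sub>R x) = c *\<^sub>R q x" for c x
    proof (cases "c \<ge> 0")
      case False
      then have "q ((- c) *\<^sub>R x) = - c * q x" by (intro sublinear_scaleR[OF q]) simp
      then show ?thesis using neg[of "c *\<^sub>R x"] by simp
    qed (simp add: sublinear_scaleR[OF q])
  qed (rule add)
qed

lemma sublinear_INF_chain: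
  fixes C :: "('a::real_vector \<Rightarrow> real) set"
  assumes "C \<noteq> {}" and sub: "\<And>q. q \<in> C \<Longrightarrow> sublinear q"
    and chain: "\<And>q r. q \<in> C \<Longrightarrow> r \<in> C \<Longrightarrow> q \<le> r \<or> r \<le> q"
    and le: "\<And>q. q \<in> C \<Longrightarrow> q \<le> p"
  shows "sublinear (\<lambda>x. INF q\<in>C. q x)" (is "sublinear ?u")
    and "\<And>q x. q \<in> C \<Longrightarrow> (INF q\<in>C. q x) \<le> q x"
proof -
  have bdd: "bdd_below ((\<lambda>q. q x) ` C)" for x
  proof (rule bdd_belowI2)
    fix q assume "q \<in> C"
    then show "- p (- x) \<le> q x"
      using sublinear_minus[OF sub, of q x] le_funD[OF le, of q "- x"] by simp
  qed
  show lower: "?u x \<le> q x" if "q \<in> C" for q x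
    by (rule cINF_lower[OF bdd that])
  show "sublinear ?u"
  proof (rule sublinearI)
    show "?u 0 = 0"
      using \<open>C \<noteq> {}\<close> by (simp add: sublinear_zero[OF sub])
  next
    fix x y
    have "?u (x + y) \<le> q x + r y" if qr: "q \<in> C" "r \<in> C" for q r
    proof -
      obtain s where "s \<in> C" "s \<le> q" "s \<le> r"
        using chain[OF qr] qr by (metis order_refl)
      then have "?u (x + y) \<le> s x + s y"
        using lower[of s "x + y"] sublinear_add[OF sub, of s x y] by simp
      also have "\<dots> \<le> q x + r y"
        using \<open>s \<le> q\<close> \<open>s \<le> r\<close> by (intro add_mono) (auto simp: le_fun_def)
      finally show ?thesis .
    qed
    then have "?u (x + y) - r y \<le> ?u x" if "r \<in> C" for r
      using that \<open>C \<noteq> {}\<close> by (intro cINF_greatest) (auto simp: algebra_simps)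
    then have "?u (x + y) - ?u x \<le> ?u y"
      using \<open>C \<noteq> {}\<close> by (intro cINF_greatest) (auto simp: algebra_simps)
    then show "?u (x + y) \<le> ?u x + ?u y" by simp
  next
    fix t :: real and x assume t: "t > 0"
    have "inverse t * ?u (t *\<^sub>R x) \<le> ?u x"
    proof (rule cINF_greatest[OF \<open>C \<noteq> {}\<close>])
      fix q assume q: "q \<in> C"
      have "q (t *\<^sub>R x) = t * q x" using t by (simp add: sublinear_scaleR[OF sub[OF q]])
      then show "inverse t * ?u (t *\<^sub>R x) \<le> q x"
        using lower[OF q, of "t *\<^sub>R x"] t by (simp add: field_simps)
    qed
    then show "?u (t *\<^sub>R x) \<le> t * ?u x" using t by (simp add: field_simps)
  qed
qed

text \<open>
  The Hahn-Banach theorem in its leanest form: Zorn's lemma yields a minimal sublinear functional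
  below \<open>p\<close>, and minimal ones are linear. Chains have lower bounds because \<open>q \<le> p\<close> implies
  \<open>q x \<ge> - p (- x)\<close>, so that pointwise infima are finite.
\<close>

theorem ex_linear_le_sublinear:
  fixes p :: "'a::real_vector \<Rightarrow> real"
  assumes p: "sublinear p"
  shows "\<exists>g. linear g \<and> g \<le> p"
proof -
  define S where "S = {q. sublinear q \<and> q \<le> p}"
  have "\<exists>m\<in>S. \<forall>a\<in>S. m \<ge> a \<longrightarrow> a = m"
  proof (rule predicate_Zorn)
    show "partial_order_on S (relation_of (\<ge>) S)"
      by (rule partial_order_on_relation_ofI) auto
  next
    fix C assume C: "C \<in> Chains (relation_of (\<ge>) S)"
    show "\<exists>u\<in>S. \<forall>a\<in>C. a \<ge> u"
    proof (cases "C = {}")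
      case True
      then show ?thesis using p by (auto simp: S_def)
    next
      case False
      have CS: "C \<subseteq> S" by (rule Chains_relation_of[OF C])
      then have sub: "sublinear q" and le: "q \<le> p" if "q \<in> C" for q
        using that by (auto simp: S_def)
      have chain: "q \<le> r \<or> r \<le> q" if "q \<in> C" "r \<in> C" for q r
        using C that unfolding Chains_def relation_of_def by auto
      note inf = sublinear_INF_chain[OF False sub chain le]
      let ?u = "\<lambda>x. INF q\<in>C. q x"
      have below: "?u \<le> q" if "q \<in> C" for q
        using inf(2)[OF _ _ _ _ that] by (auto simp: le_fun_def)
      obtain q where "q \<in> C" using False by blast
      then have "?u \<le> p" using below le by (meson order_trans)
      then have "?u \<in> S" using inf(1) unfolding S_def by blast
      then show ?thesis using below by blast
    qed
  qed
  then obtain m where m: "sublinear m" "m \<le> p" and "\<And>a. a \<in> S \<Longrightarrow> a \<le> m \<Longrightarrow> a = m"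
    unfolding S_def by blast
  then have "linear m"
    by (intro linear_if_minimal_sublinear) (auto simp: S_def intro: order_trans)
  then show ?thesis using m by blast
qed

text \<open>
  A pair \<open>(x, c)\<close> in the cone is the demand \<open>c \<le> \<phi> x\<close>; demanding also \<open>(- x, - c)\<close> prescribes the
  value exactly. The demands can be met within the dual unit ball as soon as none of them
  individually exceeds the norm. Cones are convenient because demands that hold only eventually
  along a filter, or up to finitely many exceptions, are closed under addition and scaling, so
  that generalised limits come out without any choice of an ultrafilter.
\<close>

theorem Hahn_Banach_cone:
  fixes G :: "('a::real_normed_vector \<times> real) set"
  assumes G: "convex_cone G" and le: "\<And>x c. (x, c) \<in> G \<Longrightarrow> c \<le> norm x"
  shows "\<exists>\<phi> :: 'a \<Rightarrow>\<^sub>L real. norm \<phi> \<le> 1 \<and> (\<forall>(x, c)\<in>G. c \<le> blinfun_apply \<phi> x)"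
proof -
  note lower = lower_by_le[OF sublinear_norm G le] lower_by_constraint[OF sublinear_norm G le]
  obtain g where g: "linear g" "g \<le> lower_by G norm"
    using ex_linear_le_sublinear[OF sublinear_lower_by[OF sublinear_norm G le]] by blast
  have g_le: "g x \<le> norm x" for x
    using le_funD[OF g(2), of x] lower(1)[of x] by simp
  then have abs_g: "\<bar>g x\<bar> \<le> norm x" for x
    using g_le[of "- x"] g_le[of x] by (intro abs_leI) (simp_all add: linear_neg[OF g(1)])
  then have bl: "bounded_linear g"
    using g(1) by (intro bounded_linear_intro[where K = 1]) (auto simp: linear_add linear_scale)
  have "norm (Blinfun g) \<le> 1"
    by (rule norm_blinfun_bound) (auto simp: bounded_linear_Blinfun_apply[OF bl] abs_g)
  moreover have "c \<le> Blinfun g x" if "(x, c) \<in> G" for x c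
    using le_funD[OF g(2), of "- x"] lower(2)[OF _ that]
    by (simp add: bounded_linear_Blinfun_apply[OF bl] linear_neg[OF g(1)])
  ultimately show ?thesis by blast
qed

section \<open>Norming functionals and very smooth points\<close>

text \<open>
  Only used at unit vectors \<open>z\<close>, where \<open>norm \<phi> = 1\<close> is automatic; the inequality is what survives
  composition with contractions.
\<close>

definition norming :: "('a::real_normed_vector \<Rightarrow>\<^sub>L real) \<Rightarrow> 'a \<Rightarrow> bool"
  where "norming \<phi> z \<longleftrightarrow> norm \<phi> \<le> 1 \<and> blinfun_apply \<phi> z = 1"

lemma blinfun_le_norm: "blinfun_apply \<phi> x \<le> norm \<phi> * norm x" for \<phi> :: "'a::real_normed_vector \<Rightarrow>\<^sub>L real"
  using norm_blinfun[of \<phi> x] by simp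

lemma ex_norming:
  assumes "norm z = 1"
  obtains \<phi> where "norming \<phi> z"
proof -
  have "\<exists>\<phi>. norm \<phi> \<le> 1 \<and> (\<forall>(x, c)\<in>{t *\<^sub>R (z, 1::real) | t. 0 \<le> t}. c \<le> blinfun_apply \<phi> x)"
    using assms by (intro Hahn_Banach_cone convex_cone_ray) auto
  then obtain \<phi> where \<phi>: "norm \<phi> \<le> 1"
    "\<And>x c. (x, c) \<in> {t *\<^sub>R (z, 1::real) | t. 0 \<le> t} \<Longrightarrow> c \<le> blinfun_apply \<phi> x"
    by blast
  have "(z, 1) \<in> {t *\<^sub>R (z, 1::real) | t. 0 \<le> t}" by (auto intro!: exI[of _ 1])
  from \<phi>(2)[OF this] have "1 \<le> \<phi> z" .
  moreover have "\<phi> z \<le> 1" using norm_blinfun[of \<phi> z] \<phi>(1) assms by simp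
  ultimately show ?thesis using that \<phi>(1) by (simp add: norming_def)
qed

lemma norming_iff_norm_eq_1:
  assumes "norm z = 1"
  shows "norming \<phi> z \<longleftrightarrow> norm \<phi> = 1 \<and> \<phi> z = 1"
  using norm_blinfun[of \<phi> z] assms by (auto simp: norming_def)

lemma norming_compose:
  assumes "norming \<phi> (blinfun_apply T z)" and "norm T \<le> 1"
  shows "norming (\<phi> o\<^sub>L T) z"
proof -
  have "norm (\<phi> o\<^sub>L T) \<le> norm \<phi> * norm T" by (rule norm_blinfun_compose)
  also have "\<dots> \<le> 1" using assms by (intro mult_le_one) (auto simp: norming_def)
  finally show ?thesis using assms(1) by (simp add: norming_def)
qed

lemma norm_bidual_embed_le: "norm (bidual_embed z) \<le> norm z"
  by (rule norm_blinfun_bound)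
    (use norm_blinfun in \<open>simp_all add: mult.commute[of "norm z"] flip: real_norm_def\<close>)

lemma norming_bidual_embed:
  "norming \<phi> z \<Longrightarrow> norming (bidual_embed \<phi>) (bidual_embed z)"
  using norm_bidual_embed_le[of \<phi>] by (simp add: norming_def)

lemma norm_bidual_embed_unit:
  assumes "norm z = 1"
  shows "norm (bidual_embed z) = 1"
proof (rule antisym)
  obtain \<phi> where \<phi>: "norming \<phi> z" using ex_norming[OF assms] .
  have "1 = norm (blinfun_apply (bidual_embed z) \<phi>)" using \<phi> by (simp add: norming_def)
  also have "\<dots> \<le> norm (bidual_embed z) * norm \<phi>" by (rule norm_blinfun)
  also have "\<dots> \<le> norm (bidual_embed z)"
    using \<phi> by (intro mult_left_le) (auto simp: norming_def)
  finally show "1 \<le> norm (bidual_embed z)" .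
qed (use norm_bidual_embed_le[of z] assms in simp)

lemma very_smooth_point_iff:
  "very_smooth_point z \<longleftrightarrow> norm z = 1 \<and>
    (\<forall>\<Phi> \<Psi>. norming \<Phi> (bidual_embed z) \<longrightarrow> norming \<Psi> (bidual_embed z) \<longrightarrow> \<Phi> = \<Psi>)"
proof (cases "norm z = 1")
  case True
  obtain \<phi> where "norming \<phi> z" using ex_norming[OF True] .
  then have "norming (bidual_embed \<phi>) (bidual_embed z)" by (rule norming_bidual_embed)
  then show ?thesis
    using True norm_bidual_embed_unit[OF True]
    unfolding very_smooth_point_def smooth_point_def
    by (auto simp flip: norming_iff_norm_eq_1)
qed (simp add: very_smooth_point_def)

lemma very_smooth_point_norm: "very_smooth_point z \<Longrightarrow> norm z = 1"
  and very_smooth_point_unique: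
    "very_smooth_point z \<Longrightarrow> norming \<Phi> (bidual_embed z) \<Longrightarrow> norming \<Psi> (bidual_embed z) \<Longrightarrow> \<Phi> = \<Psi>"
  by (auto simp: very_smooth_point_iff)

text \<open>
  The dual of \<open>z\<close>'s space embeds into its third dual, taking norming functionals to norming ones.
\<close>

lemma very_smooth_point_unique_norming:
  assumes "very_smooth_point z" "norming \<phi> z" "norming \<psi> z"
  shows "\<phi> = \<psi>"
proof (rule blinfun_eqI)
  fix x
  have "bidual_embed \<phi> = bidual_embed \<psi>"
    using assms by (intro very_smooth_point_unique norming_bidual_embed)
  then have "bidual_embed \<phi> (bidual_embed x) = bidual_embed \<psi> (bidual_embed x)" by simp
  then show "\<phi> x = \<psi> x" by simp
qed

section \<open>Adjoints, retractions and perturbations\<close>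

definition dual_map ::
    "('a::real_normed_vector \<Rightarrow>\<^sub>L 'b::real_normed_vector) \<Rightarrow> ('b \<Rightarrow>\<^sub>L real) \<Rightarrow>\<^sub>L ('a \<Rightarrow>\<^sub>L real)"
  where "dual_map T = Blinfun (\<lambda>\<mu>. \<mu> o\<^sub>L T)"

abbreviation bidual_map ::
    "('a::real_normed_vector \<Rightarrow>\<^sub>L 'b::real_normed_vector) \<Rightarrow>
      (('a \<Rightarrow>\<^sub>L real) \<Rightarrow>\<^sub>L real) \<Rightarrow>\<^sub>L (('b \<Rightarrow>\<^sub>L real) \<Rightarrow>\<^sub>L real)"
  where "bidual_map T \<equiv> dual_map (dual_map T)"

lemma dual_map_apply [simp]: "blinfun_apply (dual_map T) \<mu> = \<mu> o\<^sub>L T"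
  unfolding dual_map_def
  by (rule bounded_linear_Blinfun_apply[THEN fun_cong])
    (rule bounded_bilinear.bounded_linear_left[OF bounded_bilinear_blinfun_compose])

lemma norm_dual_map_le: "norm (dual_map T) \<le> norm T"
  by (rule norm_blinfun_bound) (auto simp: mult.commute intro: norm_blinfun_compose)

lemma norm_bidual_map_le: "norm (bidual_map T) \<le> norm T"
  by (rule order_trans[OF norm_dual_map_le norm_dual_map_le])

lemma bidual_map_embed: "bidual_map T (bidual_embed z) = bidual_embed (T z)"
  by (rule blinfun_eqI) simp

text \<open>
  Composition with the second adjoint of \<open>E\<close> maps norming functionals at \<open>E z\<close> to norming
  functionals at \<open>z\<close>, and injectively so, because that adjoint is onto: it has the second adjoint
  of \<open>J\<close> as a right inverse.
\<close>

lemma very_smooth_point_retract: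
  fixes E :: "'z::real_normed_vector \<Rightarrow>\<^sub>L 'x::real_normed_vector" and J :: "'x \<Rightarrow>\<^sub>L 'z"
  assumes z: "very_smooth_point z" and E: "norm E \<le> 1" and EJ: "\<And>x. E (J x) = x"
    and Ez: "norm (E z) = 1"
  shows "very_smooth_point (E z)"
  unfolding very_smooth_point_iff
proof (intro conjI allI impI)
  fix \<Phi> \<Psi>
  assume "norming \<Phi> (bidual_embed (E z))" "norming \<Psi> (bidual_embed (E z))"
  moreover have "norm (bidual_map E) \<le> 1" using norm_bidual_map_le[of E] E by simp
  ultimately have eq: "\<Phi> o\<^sub>L bidual_map E = \<Psi> o\<^sub>L bidual_map E"
    unfolding bidual_map_embed[symmetric]
    by (intro very_smooth_point_unique[OF z] norming_compose)
  show "\<Phi> = \<Psi>"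
  proof (rule blinfun_eqI)
    fix F
    have "bidual_map E (bidual_map J F) = F"
      by (rule blinfun_eqI) (auto intro!: arg_cong[of _ _ "blinfun_apply F"] blinfun_eqI simp: EJ)
    then show "\<Phi> F = \<Psi> F"
      using arg_cong[OF eq, of "\<lambda>A. blinfun_apply A (bidual_map J F)"] by simp
  qed
qed (rule Ez)

lemma norm_functional_le_ball:
  fixes \<phi> :: "'a::real_normed_vector \<Rightarrow>\<^sub>L real"
  assumes "\<And>h. norm h \<le> 1 \<Longrightarrow> \<phi> h \<le> b"
  shows "norm \<phi> \<le> b"
proof (rule norm_blinfun_bound)
  show "0 \<le> b" using assms[of 0] by simp
  fix h
  show "norm (\<phi> h) \<le> b * norm h"
  proof (cases "h = 0")
    case False
    let ?u = "h /\<^sub>R norm h"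
    have "\<phi> ?u \<le> b" "\<phi> (- ?u) \<le> b" using False by (intro assms; simp)+
    then show ?thesis
      using False by (auto simp: blinfun.bilinear_simps field_simps abs_le_iff)
  qed simp
qed

text \<open>
  Testing the hypothesis with a functional \<open>\<mu>\<close> and taking the supremum over \<open>h\<close> gives
  \<open>\<mu> z + s * norm (\<mu> \<circ> Q) \<le> norm \<mu>\<close>. This inequality no longer mentions \<open>h\<close>, and a bidual
  element \<open>F\<close> in the unit ball sees \<open>\<mu> \<circ> Q\<close> only through its norm.
\<close>

lemma norm_bidual_perturbation_le_1:
  fixes Q :: "'a::real_normed_vector \<Rightarrow>\<^sub>L 'b::real_normed_vector"
  assumes s: "s > 0" and ball: "\<And>h. norm h \<le> 1 \<Longrightarrow> norm (z + s *\<^sub>R Q h) \<le> 1"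
    and F: "norm F \<le> 1"
  shows "norm (bidual_embed z + s *\<^sub>R bidual_map Q F) \<le> 1"
proof -
  have upper: "\<mu> z + s * F (\<mu> o\<^sub>L Q) \<le> norm \<mu>" for \<mu> :: "'b \<Rightarrow>\<^sub>L real"
  proof -
    have "norm (\<mu> o\<^sub>L Q) \<le> (norm \<mu> - \<mu> z) / s"
    proof (rule norm_functional_le_ball)
      fix h :: 'a assume "norm h \<le> 1"
      have "\<mu> (z + s *\<^sub>R Q h) \<le> norm \<mu> * norm (z + s *\<^sub>R Q h)"
        by (rule blinfun_le_norm)
      also have "\<dots> \<le> norm \<mu>"
        using ball[OF \<open>norm h \<le> 1\<close>] by (intro mult_left_le) auto
      finally show "(\<mu> o\<^sub>L Q) h \<le> (norm \<mu> - \<mu> z) / s"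
        using s by (simp add: blinfun.bilinear_simps field_simps)
    qed
    moreover have "F (\<mu> o\<^sub>L Q) \<le> norm (\<mu> o\<^sub>L Q)"
      using norm_blinfun[of F "\<mu> o\<^sub>L Q"] mult_right_mono[OF F, of "norm (\<mu> o\<^sub>L Q)"] by simp
    ultimately have "F (\<mu> o\<^sub>L Q) \<le> (norm \<mu> - \<mu> z) / s" by simp
    then show ?thesis using s by (simp add: field_simps)
  qed
  show ?thesis
  proof (rule norm_functional_le_ball)
    fix \<mu> :: "'b \<Rightarrow>\<^sub>L real" assume "norm \<mu> \<le> 1"
    then show "(bidual_embed z + s *\<^sub>R bidual_map Q F) \<mu> \<le> 1"
      using upper[of \<mu>] by (simp add: blinfun.bilinear_simps)
  qed
qed

text \<open>
  \<open>\<Phi>\<close> takes its largest value 1 on the unit ball at \<open>z\<close>, so it cannot grow in the directions in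
  which \<open>z\<close> can be moved inside the ball; these directions are closed under negation.
\<close>

lemma norming_vanishes_on_perturbations:
  fixes Q :: "'a::real_normed_vector \<Rightarrow>\<^sub>L 'b::real_normed_vector"
  assumes s: "s > 0" and ball: "\<And>h. norm h \<le> 1 \<Longrightarrow> norm (z + s *\<^sub>R Q h) \<le> 1"
    and \<Phi>: "norming \<Phi> (bidual_embed z)"
  shows "\<Phi> (bidual_map Q F) = 0"
proof -
  have "norm (\<Phi> o\<^sub>L bidual_map Q) \<le> 0"
  proof (rule norm_functional_le_ball)
    fix F :: "('a \<Rightarrow>\<^sub>L real) \<Rightarrow>\<^sub>L real" assume F: "norm F \<le> 1"
    have le: "norm (bidual_embed z + s *\<^sub>R bidual_map Q F) \<le> 1"
      by (rule norm_bidual_perturbation_le_1[OF s _ F]) (rule ball)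
    have "\<Phi> (bidual_embed z + s *\<^sub>R bidual_map Q F)
        \<le> norm \<Phi> * norm (bidual_embed z + s *\<^sub>R bidual_map Q F)"
      by (rule blinfun_le_norm)
    also have "\<dots> \<le> 1" using \<Phi> le by (intro mult_le_one) (auto simp: norming_def)
    finally have "1 + s * \<Phi> (bidual_map Q F) \<le> 1"
      using \<Phi> by (simp add: blinfun.bilinear_simps norming_def)
    then show "(\<Phi> o\<^sub>L bidual_map Q) F \<le> 0"
      using s by (simp add: mult_le_0_iff)
  qed
  then have "\<Phi> o\<^sub>L bidual_map Q = 0" by simp
  from arg_cong[OF this, of "\<lambda>A. blinfun_apply A F"] show ?thesis by simp
qed

text \<open>
  The operator \<open>I - J E\<close> plays the role of the projection onto the part that \<open>E\<close> does not see. A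
  norming functional at \<open>z\<close> vanishes on the range of its second adjoint, so it factors through the
  second adjoint of \<open>E\<close>, and the factor is norming at the very smooth point \<open>E z\<close>.
\<close>

lemma very_smooth_point_lift:
  fixes E :: "'z::real_normed_vector \<Rightarrow>\<^sub>L 'x::real_normed_vector" and J :: "'x \<Rightarrow>\<^sub>L 'z"
  assumes z: "norm z = 1" and Ez: "very_smooth_point (E z)" and J: "norm J \<le> 1"
    and s: "s > 0" and ball: "\<And>h. norm h \<le> 1 \<Longrightarrow> norm (z + s *\<^sub>R (h - J (E h))) \<le> 1"
  shows "very_smooth_point z"
  unfolding very_smooth_point_iff
proof (intro conjI allI impI)
  define Q where "Q = id_blinfun - (J o\<^sub>L E)"
  have Q: "norm (z + s *\<^sub>R Q h) \<le> 1" if "norm h \<le> 1" for h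
    using ball[OF that] by (simp add: Q_def blinfun.bilinear_simps)
  \<comment> \<open>The second adjoint of the identity \<open>I = J E + Q\<close>.\<close>
  have F_eq: "F = bidual_map J (bidual_map E F) + bidual_map Q F" for F
  proof (rule blinfun_eqI)
    fix \<mu> :: "'z \<Rightarrow>\<^sub>L real"
    have "\<mu> = ((\<mu> o\<^sub>L J) o\<^sub>L E) + (\<mu> o\<^sub>L Q)"
      by (rule blinfun_eqI) (simp add: Q_def blinfun.bilinear_simps)
    from arg_cong[OF this, of "blinfun_apply F"]
    have "F \<mu> = F ((\<mu> o\<^sub>L J) o\<^sub>L E) + F (\<mu> o\<^sub>L Q)"
      unfolding blinfun.add_right .
    then show "F \<mu> = (bidual_map J (bidual_map E F) + bidual_map Q F) \<mu>"
      by (simp add: blinfun.bilinear_simps)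
  qed
  have through_E: "\<Phi> F = \<Phi> (bidual_map J (bidual_map E F))"
    if "norming \<Phi> (bidual_embed z)" for \<Phi> F
  proof -
    have "\<Phi> (bidual_map Q F) = 0"
      by (rule norming_vanishes_on_perturbations[OF s _ that]) (rule Q)
    then show ?thesis
      using arg_cong[OF F_eq[of F], of "blinfun_apply \<Phi>"] unfolding blinfun.add_right by simp
  qed
  have at_Ez: "norming (\<Phi> o\<^sub>L bidual_map J) (bidual_embed (E z))"
    if "norming \<Phi> (bidual_embed z)" for \<Phi>
  proof (rule norming_compose)
    show "norm (bidual_map J) \<le> 1" using norm_bidual_map_le[of J] J by simp
    show "norming \<Phi> (bidual_map J (bidual_embed (E z)))"
      using that through_E[OF that, of "bidual_embed z"]
      by (simp add: norming_def bidual_map_embed del: dual_map_apply)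
  qed
  fix \<Phi> \<Psi> assume *: "norming \<Phi> (bidual_embed z)" "norming \<Psi> (bidual_embed z)"
  then have eq: "\<Phi> o\<^sub>L bidual_map J = \<Psi> o\<^sub>L bidual_map J"
    using very_smooth_point_unique[OF Ez] at_Ez by blast
  show "\<Phi> = \<Psi>"
  proof (rule blinfun_eqI)
    fix F
    show "\<Phi> F = \<Psi> F"
      using arg_cong[OF eq, of "\<lambda>A. blinfun_apply A (bidual_map E F)"]
        through_E[OF *(1), of F] through_E[OF *(2), of F] by (simp del: dual_map_apply)
  qed
qed (rule z)

section \<open>Operators and functionals on spaces of continuous functions\<close>

definition eval_at :: "'k::topological_space \<Rightarrow> ('k \<Rightarrow>\<^sub>C 'x::real_normed_vector) \<Rightarrow>\<^sub>L 'x"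
  where "eval_at k = Blinfun (\<lambda>g. apply_bcontfun g k)"

lemma bounded_linear_eval: "bounded_linear (\<lambda>g. apply_bcontfun g k)"
  by (rule bounded_linear_intro[where K = 1]) (simp_all add: norm_bounded)

lemma eval_at_apply [simp]: "blinfun_apply (eval_at k) g = apply_bcontfun g k"
  unfolding eval_at_def by (simp add: bounded_linear_Blinfun_apply[OF bounded_linear_eval])

lemma norm_eval_at_le: "norm (eval_at k) \<le> 1"
  by (rule norm_blinfun_bound) (simp_all add: norm_bounded)

definition const_op :: "'x::real_normed_vector \<Rightarrow>\<^sub>L ('k::topological_space \<Rightarrow>\<^sub>C 'x)"
  where "const_op = Blinfun const_bcontfun"

lemma const_op_apply [simp]:
  "apply_bcontfun (blinfun_apply (const_op :: 'x::real_normed_vector \<Rightarrow>\<^sub>L ('k::topological_space \<Rightarrow>\<^sub>C 'x)) x) y = x"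
proof -
  have "bounded_linear (const_bcontfun :: 'x \<Rightarrow> 'k \<Rightarrow>\<^sub>C 'x)"
    by (rule bounded_linear_intro[where K = 1])
      (auto intro!: bcontfun_eqI norm_bound simp: const_bcontfun.rep_eq)
  then show ?thesis
    by (simp add: const_op_def bounded_linear_Blinfun_apply const_bcontfun.rep_eq)
qed

lemma ex_norm_attaining_point:
  fixes f :: "'k::topological_space \<Rightarrow>\<^sub>C 'x::real_normed_vector"
  assumes "compact (UNIV :: 'k set)"
  obtains k where "norm (apply_bcontfun f k) = norm f"
proof -
  obtain k where "\<And>y. norm (apply_bcontfun f y) \<le> norm (apply_bcontfun f k)"
    using continuous_attains_sup[OF assms, of "\<lambda>y. norm (apply_bcontfun f y)"]
    by (auto intro: continuous_on_norm)
  then have "norm f \<le> norm (apply_bcontfun f k)" by (rule norm_bound)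
  then show ?thesis using that norm_bounded[of f k] by (meson antisym)
qed

lemma ex_bump:
  fixes x :: "'x::real_normed_vector" and k :: "'k::t2_space"
  assumes K: "compact (UNIV :: 'k set)" and A: "closed A" "k \<notin> A"
  obtains g :: "'k \<Rightarrow>\<^sub>C 'x" where "apply_bcontfun g k = x"
    "\<And>a. a \<in> A \<Longrightarrow> apply_bcontfun g a = 0" "norm g \<le> norm x"
proof -
  have "Hausdorff_space (euclidean :: 'k topology)"
    unfolding Hausdorff_space_def disjnt_def using hausdorff by fastforce
  then have "normal_space (euclidean :: 'k topology)"
    using K by (intro compact_Hausdorff_or_regular_imp_normal_space) (auto simp: compact_space_def)
  then obtain u :: "'k \<Rightarrow> real" where u: "continuous_map euclidean (top_of_set {0..1}) u"
    "u ` A \<subseteq> {0}" "u ` {k} \<subseteq> {1}"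
    by (rule Urysohn_lemma[of _ A "{k}" 0 1]) (use A in \<open>auto simp: disjnt_def\<close>)
  have cont: "continuous_on UNIV u" and range: "0 \<le> u y" "u y \<le> 1" for y
    using u(1) by (auto simp: continuous_map_in_subtopology image_subset_iff)
  have bound: "norm (u y *\<^sub>R x) \<le> norm x" for y
    using range[of y] by (simp add: mult_left_le_one_le)
  have "(\<lambda>y. u y *\<^sub>R x) \<in> bcontfun"
    by (rule bcontfun_normI[OF _ bound]) (intro continuous_intros cont)
  then obtain g where g: "(\<lambda>y. u y *\<^sub>R x) = apply_bcontfun g" by (rule bcontfunE)
  note g_eq = fun_cong[OF g, symmetric]
  show ?thesis
    by (rule that[of g]) (use u(2,3) bound in \<open>auto simp: g_eq intro!: norm_bound\<close>)
qed

lemma norming_at_point: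
  assumes "norming \<phi> (apply_bcontfun f k)"
  shows "norming (\<phi> o\<^sub>L eval_at k) f"
  using assms by (intro norming_compose) (simp_all add: norm_eval_at_le)

section \<open>The norm is attained at a single isolated point\<close>

lemma very_smooth_norm_attaining_unique:
  fixes f :: "'k::t2_space \<Rightarrow>\<^sub>C 'x::real_normed_vector"
  assumes K: "compact (UNIV :: 'k set)" and f: "very_smooth_point f"
    and k: "norm (apply_bcontfun f k) = 1" and l: "norm (apply_bcontfun f l) = 1"
  shows "k = l"
proof (rule ccontr)
  assume "k \<noteq> l"
  obtain \<phi> where \<phi>: "norming \<phi> (apply_bcontfun f k)" using ex_norming[OF k] .
  obtain \<psi> where \<psi>: "norming \<psi> (apply_bcontfun f l)" using ex_norming[OF l] .
  have eq: "\<phi> o\<^sub>L eval_at k = \<psi> o\<^sub>L eval_at l"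
    using norming_at_point[OF \<phi>] norming_at_point[OF \<psi>] by (rule very_smooth_point_unique_norming[OF f])
  obtain g :: "'k \<Rightarrow>\<^sub>C 'x" where "apply_bcontfun g k = apply_bcontfun f k" "apply_bcontfun g l = 0"
    by (rule ex_bump[OF K, of "{l}" k "apply_bcontfun f k"]) (use \<open>k \<noteq> l\<close> in auto)
  then show False
    using arg_cong[OF eq, of "\<lambda>A. blinfun_apply A g"] \<phi> by (simp add: norming_def)
qed

text \<open>
  Under the description of functionals on \<open>C(K,X)\<close> by vector measures \<open>\<mu>\<close>, \<open>F\<close> sends \<open>\<mu>\<close> to
  \<open>\<mu>({k})\<close> applied to \<open>x\<close>. It arises as a limit of evaluations at bump functions \<open>g\<close> that
  concentrate at \<open>k\<close>. Accordingly \<open>c\<close> is a lower bound for \<open>F \<mu>\<close> if \<open>c \<le> \<mu> g\<close> for all bumps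
  vanishing on some finite set that misses \<open>k\<close>; bumps of this kind exist by Urysohn's lemma, which
  is why such a \<open>c\<close> is at most \<open>norm \<mu>\<close>.
\<close>

lemma ex_point_mass_functional:
  fixes k :: "'k::t2_space" and x :: "'x::real_normed_vector"
  assumes K: "compact (UNIV :: 'k set)" and x: "norm x \<le> 1"
  obtains F :: "(('k \<Rightarrow>\<^sub>C 'x) \<Rightarrow>\<^sub>L real) \<Rightarrow>\<^sub>L real"
  where "\<And>\<phi>. F (\<phi> o\<^sub>L eval_at k) = \<phi> x" "\<And>\<phi> l. l \<noteq> k \<Longrightarrow> F (\<phi> o\<^sub>L eval_at l) = 0"
proof -
  define bumps where "bumps A =
    {g :: 'k \<Rightarrow>\<^sub>C 'x. norm g \<le> 1 \<and> apply_bcontfun g k = x \<and> (\<forall>a\<in>A. apply_bcontfun g a = 0)}" for A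
  define G where "G = {(\<mu>, c :: real). \<exists>A. finite A \<and> k \<notin> A \<and> (\<forall>g\<in>bumps A. c \<le> blinfun_apply \<mu> g)}"
  have "convex_cone G"
    unfolding convex_cone_iff
  proof (intro conjI ballI allI impI)
    show "0 \<in> G" by (auto simp: G_def zero_prod_def intro: exI[of _ "{}"])
  next
    fix p q assume "p \<in> G" "q \<in> G"
    then obtain \<mu> c A \<nu> d B where p: "p = (\<mu>, c)" "finite A" "k \<notin> A" "\<And>g. g \<in> bumps A \<Longrightarrow> c \<le> \<mu> g"
      and q: "q = (\<nu>, d)" "finite B" "k \<notin> B" "\<And>g. g \<in> bumps B \<Longrightarrow> d \<le> \<nu> g"
      by (auto simp: G_def)
    have "c + d \<le> (\<mu> + \<nu>) g" if "g \<in> bumps (A \<union> B)" for g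
      using p(4)[of g] q(4)[of g] that by (auto simp: bumps_def blinfun.add_left)
    then show "p + q \<in> G"
      using p(1-3) q(1-3) by (auto simp: G_def intro!: exI[of _ "A \<union> B"])
  next
    fix p and t :: real assume "p \<in> G" "0 \<le> t"
    then obtain \<mu> c A where p: "p = (\<mu>, c)" "finite A" "k \<notin> A" "\<And>g. g \<in> bumps A \<Longrightarrow> c \<le> \<mu> g"
      by (auto simp: G_def)
    have "t * c \<le> (t *\<^sub>R \<mu>) g" if "g \<in> bumps A" for g
      using mult_left_mono[OF p(4)[OF that] \<open>0 \<le> t\<close>] by (simp add: blinfun.scaleR_left)
    then show "t *\<^sub>R p \<in> G"
      using p(1-3) by (auto simp: G_def intro!: exI[of _ A])
  qed
  moreover have "c \<le> norm \<mu>" if mem: "(\<mu>, c) \<in> G" for \<mu> c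
  proof -
    obtain A where A: "finite A" "k \<notin> A" "\<And>g. g \<in> bumps A \<Longrightarrow> c \<le> \<mu> g"
      using mem by (auto simp: G_def)
    obtain g :: "'k \<Rightarrow>\<^sub>C 'x" where g: "apply_bcontfun g k = x"
      "\<And>a. a \<in> A \<Longrightarrow> apply_bcontfun g a = 0" "norm g \<le> norm x"
      using ex_bump[OF K finite_imp_closed[OF A(1)] A(2), of x] by blast
    have "c \<le> \<mu> g" using g x by (intro A(3)) (auto simp: bumps_def)
    also have "\<dots> \<le> norm \<mu> * norm g" by (rule blinfun_le_norm)
    also have "\<dots> \<le> norm \<mu>" using g(3) x by (intro mult_left_le) auto
    finally show ?thesis .
  qed
  ultimately have "\<exists>F. norm F \<le> 1 \<and> (\<forall>(\<mu>, c)\<in>G. c \<le> blinfun_apply F \<mu>)"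
    by (rule Hahn_Banach_cone)
  then obtain F where F: "\<And>\<mu> c. (\<mu>, c) \<in> G \<Longrightarrow> c \<le> blinfun_apply F \<mu>"
    by blast
  have F_eq: "F \<mu> = c" if "finite A" "k \<notin> A" "\<And>g. g \<in> bumps A \<Longrightarrow> \<mu> g = c"
    for \<mu> :: "('k \<Rightarrow>\<^sub>C 'x) \<Rightarrow>\<^sub>L real" and c A
  proof -
    have "(\<mu>, c) \<in> G" "(- \<mu>, - c) \<in> G"
      using that by (auto simp: G_def blinfun.minus_left intro!: exI[of _ A])
    then have "c \<le> F \<mu>" "- c \<le> F (- \<mu>)" by (auto intro: F)
    then show ?thesis by (simp add: blinfun.minus_right)
  qed
  show ?thesis
  proof (rule that)
    show "F (\<phi> o\<^sub>L eval_at k) = \<phi> x" for \<phi>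
      by (rule F_eq[of "{}"]) (auto simp: bumps_def)
    show "F (\<phi> o\<^sub>L eval_at l) = 0" if "l \<noteq> k" for \<phi> l
      by (rule F_eq[of "{l}"]) (use that in \<open>auto simp: bumps_def\<close>)
  qed
qed

text \<open>
  If \<open>k\<close> is an accumulation point, a generalised limit \<open>\<Psi>\<close> of the evaluations at \<open>\<delta> l\<close>, as \<open>l\<close>
  tends to \<open>k\<close> without reaching it, competes with the evaluation at \<open>\<delta> k\<close>. On \<open>f\<close> both are 1, since
  \<open>f\<close> is continuous, but the point mass functional \<open>F\<close> jumps at \<open>k\<close> and separates them.
\<close>

lemma very_smooth_norm_attaining_isolated:
  fixes f :: "'k::t2_space \<Rightarrow>\<^sub>C 'x::real_normed_vector"
  assumes K: "compact (UNIV :: 'k set)" and f: "very_smooth_point f"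
    and k: "norm (apply_bcontfun f k) = 1"
  shows "k isolated_in UNIV"
proof (rule ccontr)
  assume "\<not> k isolated_in UNIV"
  then have nontrivial: "at k \<noteq> bot"
    by (simp add: isolated_in_islimpt_iff trivial_limit_within)
  obtain \<phi> where \<phi>: "norming \<phi> (apply_bcontfun f k)" using ex_norming[OF k] .
  define \<delta> where "\<delta> l = \<phi> o\<^sub>L eval_at l" for l :: 'k
  have norm_\<delta>: "norm (\<delta> l) \<le> 1" for l
  proof -
    have "norm (\<delta> l) \<le> norm \<phi> * norm (eval_at l :: ('k \<Rightarrow>\<^sub>C 'x) \<Rightarrow>\<^sub>L 'x)"
      unfolding \<delta>_def by (rule norm_blinfun_compose)
    also have "\<dots> \<le> 1"
      using \<phi> norm_eval_at_le by (intro mult_le_one) (auto simp: norming_def)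
    finally show ?thesis .
  qed
  obtain F :: "(('k \<Rightarrow>\<^sub>C 'x) \<Rightarrow>\<^sub>L real) \<Rightarrow>\<^sub>L real"
    where "\<And>\<phi>. F (\<phi> o\<^sub>L eval_at k) = \<phi> (apply_bcontfun f k)"
      "\<And>\<phi> l. l \<noteq> k \<Longrightarrow> F (\<phi> o\<^sub>L eval_at l) = 0"
    using ex_point_mass_functional[OF K eq_refl[OF k]] by blast
  then have F: "F (\<delta> k) = 1" "\<And>l. l \<noteq> k \<Longrightarrow> blinfun_apply F (\<delta> l) = 0"
    using \<phi> by (simp_all add: norming_def \<delta>_def)
  \<comment> \<open>\<open>c\<close> is a lower bound for \<open>\<Psi> H\<close> if it is at most the limit inferior of \<open>H (\<delta> l)\<close>.\<close>
  define G where "G = {(H, c :: real). \<forall>e>0. \<forall>\<^sub>F l in at k. c - e \<le> blinfun_apply H (\<delta> l)}"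
  have "convex_cone G"
    unfolding convex_cone_iff
  proof (intro conjI ballI allI impI)
    show "0 \<in> G" by (auto simp: G_def zero_prod_def)
  next
    fix p q assume "p \<in> G" "q \<in> G"
    then obtain H c I d where p: "p = (H, c)" "\<And>e. e > 0 \<Longrightarrow> \<forall>\<^sub>F l in at k. c - e \<le> H (\<delta> l)"
      and q: "q = (I, d)" "\<And>e. e > 0 \<Longrightarrow> \<forall>\<^sub>F l in at k. d - e \<le> I (\<delta> l)"
      by (auto simp: G_def)
    have "\<forall>\<^sub>F l in at k. (c + d) - e \<le> (H + I) (\<delta> l)" if "e > 0" for e
    proof -
      have "e / 2 > 0" using that by simp
      from p(2)[OF this] q(2)[OF this] show ?thesis
        by eventually_elim (simp add: blinfun.add_left)
    qed
    then show "p + q \<in> G" by (simp add: p(1) q(1) G_def)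
  next
    fix p and t :: real assume "p \<in> G" "0 \<le> t"
    then obtain H c where p: "p = (H, c)" "\<And>e. e > 0 \<Longrightarrow> \<forall>\<^sub>F l in at k. c - e \<le> H (\<delta> l)"
      by (auto simp: G_def)
    have "\<forall>\<^sub>F l in at k. t * c - e \<le> (t *\<^sub>R H) (\<delta> l)" if "e > 0" for e
    proof (cases "t = 0")
      case False
      then have t: "t > 0" using \<open>0 \<le> t\<close> by simp
      then show ?thesis
        using p(2)[of "e / t"] that
        by (auto elim!: eventually_mono simp: blinfun.scaleR_left field_simps)
    qed (use that in \<open>simp add: blinfun.scaleR_left\<close>)
    then show "t *\<^sub>R p \<in> G" by (simp add: p(1) G_def)
  qed
  moreover have "c \<le> norm H" if "(H, c) \<in> G" for H c
  proof (rule field_le_epsilon)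
    fix e :: real assume "e > 0"
    then have "\<forall>\<^sub>F l in at k. c - e \<le> H (\<delta> l)" using that by (simp add: G_def)
    then obtain l where "c - e \<le> H (\<delta> l)"
      using eventually_happens nontrivial by blast
    also have "\<dots> \<le> norm H * norm (\<delta> l)" by (rule blinfun_le_norm)
    also have "\<dots> \<le> norm H" using norm_\<delta> by (intro mult_left_le) auto
    finally show "c \<le> norm H + e" by simp
  qed
  ultimately have "\<exists>\<Psi>. norm \<Psi> \<le> 1 \<and> (\<forall>(H, c)\<in>G. c \<le> blinfun_apply \<Psi> H)"
    by (rule Hahn_Banach_cone)
  then obtain \<Psi> where \<Psi>: "norm \<Psi> \<le> 1" "\<And>H c. (H, c) \<in> G \<Longrightarrow> c \<le> blinfun_apply \<Psi> H"
    by blast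
  have limit: "\<Psi> H = c" if "((\<lambda>l. blinfun_apply H (\<delta> l)) \<longlongrightarrow> c) (at k)" for H c
  proof -
    have in_G: "(H', c') \<in> G" if lim: "((\<lambda>l. blinfun_apply H' (\<delta> l)) \<longlongrightarrow> c') (at k)" for H' c'
    proof -
      have "\<forall>\<^sub>F l in at k. c' - e \<le> blinfun_apply H' (\<delta> l)" if "e > 0" for e
        using order_tendstoD(1)[OF lim, of "c' - e"] that by (auto elim!: eventually_mono)
      then show ?thesis by (simp add: G_def)
    qed
    have "(H, c) \<in> G" by (rule in_G) (rule that)
    moreover have "(- H, - c) \<in> G"
      by (rule in_G) (use tendsto_minus[OF that] in \<open>simp add: blinfun.minus_left\<close>)
    ultimately have "c \<le> \<Psi> H" "- c \<le> \<Psi> (- H)" by (auto intro: \<Psi>(2))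
    then show ?thesis by (simp add: blinfun.minus_right)
  qed
  have "\<Psi> (bidual_embed f) = 1"
  proof (rule limit)
    have "isCont (apply_bcontfun f) k"
      using continuous_on_apply_bcontfun[of UNIV f] continuous_on_eq_continuous_at[OF open_UNIV]
      by blast
    then have "((\<lambda>l. \<phi> (apply_bcontfun f l)) \<longlongrightarrow> \<phi> (apply_bcontfun f k)) (at k)"
      by (intro blinfun.tendsto tendsto_const) (simp add: isCont_def)
    then show "((\<lambda>l. bidual_embed f (\<delta> l)) \<longlongrightarrow> 1) (at k)"
      using \<phi> by (simp add: norming_def \<delta>_def)
  qed
  then have "norming \<Psi> (bidual_embed f)" using \<Psi>(1) by (simp add: norming_def)
  moreover have "norming (bidual_embed (\<delta> k)) (bidual_embed f)"
    unfolding \<delta>_def by (intro norming_bidual_embed norming_at_point \<phi>)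
  ultimately have "\<Psi> = bidual_embed (\<delta> k)" by (rule very_smooth_point_unique[OF f])
  then have "\<Psi> F = 1" using F(1) by simp
  moreover have "\<Psi> F = 0"
    by (rule limit) (auto intro!: tendsto_eventually simp: F(2) eventually_at_filter)
  ultimately show False by simp
qed

section \<open>Isolated points suffice\<close>

lemma ex_norm_gap:
  fixes f :: "'k::t2_space \<Rightarrow>\<^sub>C 'x::real_normed_vector"
  assumes K: "compact (UNIV :: 'k set)" and "open {k}"
    and less: "\<And>l. l \<noteq> k \<Longrightarrow> norm (apply_bcontfun f l) < 1"
  obtains s where "s > 0" "\<And>l. l \<noteq> k \<Longrightarrow> norm (apply_bcontfun f l) + s \<le> 1"
proof (cases "UNIV - {k} = {}")
  case True
  then show ?thesis using that[of 1] by auto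
next
  case False
  have "compact (UNIV - {k})" using K \<open>open {k}\<close> by (rule compact_diff)
  then obtain m where "m \<noteq> k" "\<And>l. l \<noteq> k \<Longrightarrow> norm (apply_bcontfun f l) \<le> norm (apply_bcontfun f m)"
    using continuous_attains_sup[OF _ False, of "\<lambda>y. norm (apply_bcontfun f y)"]
    by (auto intro: continuous_on_norm)
  then show ?thesis
    using less[of m] that[of "1 - norm (apply_bcontfun f m)"] by fastforce
qed

text \<open>
  Functions supported at the isolated point \<open>k\<close>, a copy of the target space.
\<close>

lemma ex_point_supported_op:
  fixes k :: "'k::t2_space"
  assumes "open {k}"
  obtains J :: "'x::real_normed_vector \<Rightarrow>\<^sub>L ('k \<Rightarrow>\<^sub>C 'x)" where "norm J \<le> 1"
    "\<And>x l. apply_bcontfun (J x) l = (if l = k then x else 0)"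
proof -
  define j :: "'x \<Rightarrow> 'k \<Rightarrow>\<^sub>C 'x" where "j x = Bcontfun (\<lambda>l. if l = k then x else 0)" for x
  have "(\<lambda>l. if l = k then x else 0) \<in> bcontfun" for x :: 'x
  proof (rule bcontfun_normI[where b = "norm x"])
    have "continuous_on (- {k}) (\<lambda>l. if l = k then x else 0)"
      by (rule continuous_on_eq[OF continuous_on_const[of _ 0]]) simp
    then have "continuous_on ({k} \<union> - {k}) (\<lambda>l. if l = k then x else 0)"
      using assms by (intro continuous_on_open_Un) auto
    then show "continuous_on UNIV (\<lambda>l. if l = k then x else 0)" by simp
  qed simp
  then have j: "apply_bcontfun (j x) l = (if l = k then x else 0)" for x l
    by (simp add: j_def Bcontfun_inverse)
  have norm_j: "norm (j x) \<le> norm x" for x by (rule norm_bound) (simp add: j)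
  have "bounded_linear j"
    by (rule bounded_linear_intro[where K = 1]) (auto intro!: bcontfun_eqI simp: j norm_j)
  then have J: "blinfun_apply (Blinfun j) = j" by (rule bounded_linear_Blinfun_apply)
  show ?thesis
    by (rule that[of "Blinfun j"]) (auto simp: J j norm_j intro!: norm_blinfun_bound)
qed

lemma very_smooth_if_isolated:
  fixes f :: "'k::t2_space \<Rightarrow>\<^sub>C 'x::real_normed_vector"
  assumes K: "compact (UNIV :: 'k set)"
    and unique: "\<And>l. norm (apply_bcontfun f l) = norm f \<longleftrightarrow> l = k"
    and isolated: "k isolated_in UNIV" and fk: "very_smooth_point (apply_bcontfun f k)"
  shows "very_smooth_point f"
proof -
  have norm_f: "norm f = 1" using unique[of k] very_smooth_point_norm[OF fk] by simp
  have "open {k}" using isolated by (auto simp: isolated_in_def)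
  obtain J :: "'x \<Rightarrow>\<^sub>L ('k \<Rightarrow>\<^sub>C 'x)" where J: "norm J \<le> 1"
    "\<And>x l. apply_bcontfun (J x) l = (if l = k then x else 0)"
    using ex_point_supported_op[OF \<open>open {k}\<close>] by blast
  have "norm (apply_bcontfun f l) < 1" if "l \<noteq> k" for l
    using unique[of l] norm_bounded[of f l] norm_f that by simp
  then obtain s where s: "s > 0" "\<And>l. l \<noteq> k \<Longrightarrow> norm (apply_bcontfun f l) + s \<le> 1"
    using ex_norm_gap[OF K \<open>open {k}\<close>, of f] by blast
  show ?thesis
  proof (rule very_smooth_point_lift[OF norm_f _ J(1) s(1)])
    show "very_smooth_point (eval_at k f)" using fk by simp
    fix h :: "'k \<Rightarrow>\<^sub>C 'x" assume h: "norm h \<le> 1"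
    show "norm (f + s *\<^sub>R (h - J (eval_at k h))) \<le> 1"
    proof (rule norm_bound)
      fix l
      show "norm (apply_bcontfun (f + s *\<^sub>R (h - J (eval_at k h))) l) \<le> 1"
      proof (cases "l = k")
        case True
        then show ?thesis using norm_bounded[of f k] norm_f by (simp add: J)
      next
        case False
        have "norm (apply_bcontfun f l + s *\<^sub>R apply_bcontfun h l)
            \<le> norm (apply_bcontfun f l) + s * norm (apply_bcontfun h l)"
          using norm_triangle_ineq[of "apply_bcontfun f l" "s *\<^sub>R apply_bcontfun h l"] s(1) by simp
        also have "\<dots> \<le> norm (apply_bcontfun f l) + s"
          using s(1) h norm_bounded[of h l] by (simp add: mult_left_le)
        also have "\<dots> \<le> 1" by (rule s(2)[OF False])
        finally show ?thesis using False by (simp add: J)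
      qed
    qed
  qed
qed

theorem corollary15:
  fixes f :: "'k::t2_space \<Rightarrow>\<^sub>C 'x::banach"
  assumes "compact (UNIV :: 'k set)"
  shows "very_smooth_point f \<longleftrightarrow>
    (\<exists>k. (\<forall>k'. norm (apply_bcontfun f k') = norm f \<longleftrightarrow> k' = k) \<and>
         k isolated_in UNIV \<and> very_smooth_point (apply_bcontfun f k))"
proof
  assume f: "very_smooth_point f"
  then have norm_f: "norm f = 1" by (rule very_smooth_point_norm)
  obtain k where k: "norm (apply_bcontfun f k) = norm f"
    using ex_norm_attaining_point[OF assms] .
  have "very_smooth_point (eval_at k f)"
    by (rule very_smooth_point_retract[OF f norm_eval_at_le, where J = const_op])
      (use k norm_f in simp_all)
  moreover have "norm (apply_bcontfun f k') = norm f \<longleftrightarrow> k' = k" for k'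
    using very_smooth_norm_attaining_unique[OF assms f, of k' k] k norm_f by auto
  moreover have "k isolated_in UNIV"
    using very_smooth_norm_attaining_isolated[OF assms f] k norm_f by simp
  ultimately show "\<exists>k. (\<forall>k'. norm (apply_bcontfun f k') = norm f \<longleftrightarrow> k' = k) \<and>
         k isolated_in UNIV \<and> very_smooth_point (apply_bcontfun f k)"
    by auto
next
  assume "\<exists>k. (\<forall>k'. norm (apply_bcontfun f k') = norm f \<longleftrightarrow> k' = k) \<and>
         k isolated_in UNIV \<and> very_smooth_point (apply_bcontfun f k)"
  then show "very_smooth_point f"
    using very_smooth_if_isolated[OF assms] by blast
qed

end
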